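(* Let $\alpha\in(0,1)$, $n\ge2$, and let $(x_i)_{i=1}^n,(y_i)_{i=1}^n\subseteq(0,1)$ be all distinct. Define, for $t\in[0,1]$, $$F(t)=\sum_{i=1}^n 1_{\{x_i\le t\}},\qquad \tilde F(t)=\sum_{i=1}^n 1_{\{y_i\le t\}}.$$ Then the infimum defining $\mathsf{M}^D_\alpha((x_i)_{i=1}^n,(y_i)_{i=1}^n)$ can be restricted to $m\le[F-\tilde F]_{C^0}$ (without changing its value), while the infimum defining $\mathsf{TSP}^D_\alpha((x_i)_{i=1}^n,(y_i)_{i=1}^n)$ can be restricted to $m\le[F-\tilde F]_{C^0}+1$ (without changing its value).
   Context: For $h:[0,1]\to\mathbb{R}$, $[h]_{C^0}=\sup_{s,t\in[0,1]}|h(t)-h(s)|$ (oscillation). For $N\geq 1$ and points $(x_i)_{i=1}^N,(y_i)_{i=1}^N\subseteq\mathbb{R}$, with $\mathcal{S}_N$ the set of permutations of $\{1,\dots,N\}$, $$\mathsf{M}_\alpha((x_i)_{i=1}^N,(y_i)_{i=1}^N)=\min_{\sigma\in\mathcal{S}_N}\sum_{i=1}^N|x_i-y_{\sigma(i)}|^\alpha,$$ $$\mathsf{TSP}_\alpha((x_i)_{i=1}^N,(y_i)_{i=1}^N)=\min_{\sigma,\tau\in\mathcal{S}_N}\sum_{i=1}^N\Big(|x_{\sigma(i)}-y_{\tau(i)}|^\alpha+|y_{\tau(i)}-x_{\sigma(i+1)}|^\alpha\Big),\quad\sigma(N+1):=\sigma(1).$$ Boundary functionals: for $(x_i)_{i=1}^n,(y_i)_{i=1}^n\subseteq(0,1)$,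 $$\mathsf{M}^D_\alpha((x_i)_{i=1}^n,(y_i)_{i=1}^n)=\inf\mathsf{M}_\alpha\big((x_i)_{i=1}^n\cup(\tilde x_j)_{j=1}^m,(y_i)_{i=1}^n\cup(\tilde y_j)_{j=1}^m\big),$$ $$\mathsf{TSP}^D_\alpha((x_i)_{i=1}^n,(y_i)_{i=1}^n)=\inf\mathsf{TSP}_\alpha\big((x_i)_{i=1}^n\cup(\tilde x_j)_{j=1}^m,(y_i)_{i=1}^n\cup(\tilde y_j)_{j=1}^m\big),$$ where in both cases the infimum runs over all integers $m\ge0$ and all families (repetitions allowed) of boundary points $(\tilde x_j)_{j=1}^m,(\tilde y_j)_{j=1}^m\subseteq\{0,1\}$; the unions denote concatenated families of $n+m$ points. *)

theory Defs
  imports Complex_Main "HOL-Combinatorics.Permutations"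
begin

text \<open>A family \<open>(x\<^sub>i)\<close>, \<open>1 \<le> i \<le> N\<close>, of reals is a function \<open>nat \<Rightarrow> real\<close> together
  with its length \<open>N\<close>; values outside \<open>{1..N}\<close> are irrelevant.\<close>

definition oscillation :: "(real \<Rightarrow> real) \<Rightarrow> real" where
  "oscillation h = (SUP (s, t) \<in> {0..1} \<times> {0..1}. \<bar>h t - h s\<bar>)"

definition count_le :: "nat \<Rightarrow> (nat \<Rightarrow> real) \<Rightarrow> real \<Rightarrow> real" where
  "count_le n x t = (\<Sum>i = 1..n. if x i \<le> t then 1 else 0)"

definition matching_cost ::
  "real \<Rightarrow> nat \<Rightarrow> (nat \<Rightarrow> real) \<Rightarrow> (nat \<Rightarrow> real) \<Rightarrow> real" where
  "matching_cost \<alpha> N x y =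
     Min ((\<lambda>\<sigma>. \<Sum>i = 1..N. \<bar>x i - y (\<sigma> i)\<bar> powr \<alpha>) ` {\<sigma>. \<sigma> permutes {1..N}})"

definition cyc_suc :: "nat \<Rightarrow> nat \<Rightarrow> nat" where
  "cyc_suc N i = (if i = N then 1 else i + 1)"

definition tsp_cost ::
  "real \<Rightarrow> nat \<Rightarrow> (nat \<Rightarrow> real) \<Rightarrow> (nat \<Rightarrow> real) \<Rightarrow> real" where
  "tsp_cost \<alpha> N x y =
     Min ((\<lambda>(\<sigma>, \<tau>). \<Sum>i = 1..N.
              \<bar>x (\<sigma> i) - y (\<tau> i)\<bar> powr \<alpha> + \<bar>y (\<tau> i) - x (\<sigma> (cyc_suc N i))\<bar> powr \<alpha>)
          ` ({\<sigma>. \<sigma> permutes {1..N}} \<times> {\<tau>. \<tau> permutes {1..N}}))"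

definition concat_fam :: "nat \<Rightarrow> (nat \<Rightarrow> real) \<Rightarrow> (nat \<Rightarrow> real) \<Rightarrow> nat \<Rightarrow> real" where
  "concat_fam n x u i = (if i \<le> n then x i else u (i - n))"

text \<open>Pairs of families of \<open>m\<close> boundary points of \<open>[0,1]\<close>, repetitions allowed, with
  \<open>m\<close> ranging over \<open>A\<close>.\<close>

definition boundary_fams :: "nat set \<Rightarrow> (nat \<times> (nat \<Rightarrow> real) \<times> (nat \<Rightarrow> real)) set" where
  "boundary_fams A = {(m, u, v). m \<in> A \<and> (\<forall>j\<in>{1..m}. u j \<in> {0, 1} \<and> v j \<in> {0, 1})}"

definition boundary_matching_cost ::
  "real \<Rightarrow> nat \<Rightarrow> (nat \<Rightarrow> real) \<Rightarrow> (nat \<Rightarrow> real) \<Rightarrow> real" where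
  "boundary_matching_cost \<alpha> n x y =
     (INF (m, u, v) \<in> boundary_fams UNIV.
        matching_cost \<alpha> (n + m) (concat_fam n x u) (concat_fam n y v))"

definition boundary_tsp_cost ::
  "real \<Rightarrow> nat \<Rightarrow> (nat \<Rightarrow> real) \<Rightarrow> (nat \<Rightarrow> real) \<Rightarrow> real" where
  "boundary_tsp_cost \<alpha> n x y =
     (INF (m, u, v) \<in> boundary_fams UNIV.
        tsp_cost \<alpha> (n + m) (concat_fam n x u) (concat_fam n y v))"

end

theory Submission
  imports Defs
begin

text \<open>As long as \<open>m\<close> exceeds the bound, one pair of boundary points can be removed without
  raising the cost. If a boundary point occurs in both families, its two copies are removed
  using the triangle inequality for \<open>\<bar>a - b\<bar> powr \<alpha>\<close>. Otherwise, up to symmetry, the first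
  family has all its boundary points at \<open>0\<close> and the second at \<open>1\<close>. Since \<open>m\<close> is large,
  every \<open>t\<close> is crossed by pairs with first point \<open>x \<le> t\<close> and second point \<open>y > t\<close>; by
  concavity, exchanging partners between \<open>(0, w)\<close> and a pair crossing \<open>w\<close> does not raise the
  cost and connects \<open>0\<close> to a point further right. Eventually \<open>0\<close> is connected to \<open>1\<close>,
  and both can be removed.\<close>

subsection \<open>The concave cost\<close>

text \<open>The derivative in \<open>t\<close> of
  \<open>(t + h) powr \<alpha> - t powr \<alpha>\<close> is nonpositive because
  \<open>\<alpha> - 1 < 0\<close>. It is taken only at interior points, since \<open>u = 0\<close>
  is allowed.\<close>

lemma powr_increment_antimono:
  fixes \<alpha> :: real
  assumes "0 < \<alpha>" "\<alpha> < 1" "0 \<le> u" "u \<le> v" "0 \<le> h"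
  shows "(v + h) powr \<alpha> - v powr \<alpha> \<le> (u + h) powr \<alpha> - u powr \<alpha>"
proof (rule DERIV_nonpos_imp_decreasing_open[OF \<open>u \<le> v\<close>])
  fix t assume t: "u < t" "t < v"
  then have "((\<lambda>t. (t + h) powr \<alpha> - t powr \<alpha>) has_real_derivative
      \<alpha> * (t + h) powr (\<alpha> - 1) - \<alpha> * t powr (\<alpha> - 1)) (at t)"
    using assms by (auto intro!: derivative_eq_intros simp: powr_diff)
  moreover have "(t + h) powr (\<alpha> - 1) \<le> t powr (\<alpha> - 1)"
    using assms t by (intro powr_mono2') auto
  ultimately show "\<exists>y. ((\<lambda>t. (t + h) powr \<alpha> - t powr \<alpha>) has_real_derivative y) (at t) \<and> y \<le> 0"
    using assms by (intro exI conjI) auto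
next
  show "continuous_on {u..v} (\<lambda>t. (t + h) powr \<alpha> - t powr \<alpha>)"
    using assms by (intro continuous_intros continuous_on_powr') auto
qed

text \<open>Concavity favours nested intervals over crossing ones: extending by \<open>y - w\<close>
  costs no more for the longer interval from \<open>a\<close> to \<open>w\<close> than for the
  shorter one from \<open>x\<close> to \<open>w\<close>.\<close>

lemma powr_uncross:
  fixes \<alpha> :: real
  assumes "0 < \<alpha>" "\<alpha> < 1" "a \<le> x" "x \<le> w" "w \<le> y"
  shows "\<bar>a - y\<bar> powr \<alpha> + \<bar>x - w\<bar> powr \<alpha> \<le> \<bar>a - w\<bar> powr \<alpha> + \<bar>x - y\<bar> powr \<alpha>"
  using powr_increment_antimono[OF assms(1,2), of "w - x" "w - a" "y - w"] assms by simp

text \<open>Subadditivity of the power is the increment comparison with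
  \<open>u = 0\<close>.\<close>

lemma powr_triangle:
  fixes \<alpha> a b c :: real
  assumes "0 < \<alpha>" "\<alpha> < 1"
  shows "\<bar>a - c\<bar> powr \<alpha> \<le> \<bar>a - b\<bar> powr \<alpha> + \<bar>b - c\<bar> powr \<alpha>"
proof -
  have "\<bar>a - c\<bar> powr \<alpha> \<le> (\<bar>a - b\<bar> + \<bar>b - c\<bar>) powr \<alpha>"
    using assms by (intro powr_mono2) auto
  also have "\<dots> \<le> \<bar>a - b\<bar> powr \<alpha> + \<bar>b - c\<bar> powr \<alpha>"
    using powr_increment_antimono[OF assms, of 0 "\<bar>a - b\<bar>" "\<bar>b - c\<bar>"] by simp
  finally show ?thesis .
qed

subsection \<open>Matchings of multisets\<close>

definition num_le :: "real \<Rightarrow> real multiset \<Rightarrow> nat" where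
  "num_le t X = size {#z \<in># X. z \<le> t#}"

lemma num_le_simps [simp]:
  "num_le t {#} = 0"
  "num_le t (add_mset z X) = (if z \<le> t then 1 else 0) + num_le t X"
  "num_le t (X + Y) = num_le t X + num_le t Y"
  "num_le t (replicate_mset k z) = (if z \<le> t then k else 0)"
  by (induction k) (auto simp: num_le_def)

text \<open>This is the termination measure of the exchange arguments: when a partner moves from
  \<open>w\<close> to \<open>y\<close>, the point \<open>y\<close> itself drops out of the
  count.\<close>

lemma size_filter_greater_less:
  fixes w y :: "'a::linorder"
  assumes "y \<in># Y" "w < y"
  shows "size {#z \<in># Y. y < z#} < size {#z \<in># Y. w < z#}"
proof -
  have "{#z \<in># Y. y < z#} = {#z \<in># {#z \<in># Y. w < z#}. y < z#}"
    using assms by (auto simp: filter_filter_mset intro!: filter_mset_cong)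
  then have "{#z \<in># Y. y < z#} \<subseteq># {#z \<in># Y. w < z#}" by (metis multiset_filter_subset)
  moreover have "y \<in># {#z \<in># Y. w < z#}" "y \<notin># {#z \<in># Y. y < z#}"
    using assms by auto
  ultimately show ?thesis by (metis mset_subset_size subset_mset.le_neq_trans)
qed

text \<open>Multisets of pairs forget the indices, so equal boundary points are interchangeable and
  an exchange of partners just replaces two elements.\<close>

definition matching :: "real multiset \<Rightarrow> real multiset \<Rightarrow> (real \<times> real) multiset \<Rightarrow> bool" where
  "matching X Y P \<longleftrightarrow> image_mset fst P = X \<and> image_mset snd P = Y"

definition pairs_cost :: "real \<Rightarrow> (real \<times> real) multiset \<Rightarrow> real" where
  "pairs_cost \<alpha> P = (\<Sum>(a, b)\<in>#P. \<bar>a - b\<bar> powr \<alpha>)"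

lemma pairs_cost_simps [simp]:
  "pairs_cost \<alpha> {#} = 0"
  "pairs_cost \<alpha> (add_mset (a, b) P) = \<bar>a - b\<bar> powr \<alpha> + pairs_cost \<alpha> P"
  by (auto simp: pairs_cost_def)

text \<open>A pair that does not cross \<open>t\<close> in this direction counts on the second side
  whenever it counts on the first, so discarding it keeps the inequality strict.\<close>

lemma crossing_pair:
  assumes "num_le t (image_mset snd P) < num_le t (image_mset fst P)"
  obtains x y where "(x, y) \<in># P" "x \<le> t" "t < y"
proof -
  have "\<exists>x y. (x, y) \<in># P \<and> x \<le> t \<and> t < y"
    using assms
  proof (induction P)
    case (add p P)
    then show ?case by (cases p) (fastforce split: if_splits)
  qed simp
  then show ?thesis using that by blast
qed

lemma matching_flip:
  "matching X Y P \<Longrightarrow> matching Y X (image_mset prod.swap P)"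
  "pairs_cost \<alpha> (image_mset prod.swap P) = pairs_cost \<alpha> P"
  by (auto simp: matching_def pairs_cost_def multiset.map_comp comp_def case_prod_unfold abs_minus_commute)

text \<open>Either \<open>e\<close> is paired with itself, at cost \<open>0\<close>, or its two
  partners are joined and the triangle inequality through \<open>e\<close> applies.\<close>

lemma matching_remove_common:
  assumes \<alpha>: "0 < \<alpha>" "\<alpha> < 1"
    and P: "matching (add_mset e X) (add_mset e Y) P"
  shows "\<exists>P'. matching X Y P' \<and> pairs_cost \<alpha> P' \<le> pairs_cost \<alpha> P"
proof (cases "(e, e) \<in># P")
  case True
  then obtain Q where "P = add_mset (e, e) Q" by (auto dest: multi_member_split)
  then show ?thesis using P by (intro exI[of _ Q]) (auto simp: matching_def)
next
  case False
  have "e \<in># image_mset fst P" "e \<in># image_mset snd P"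
    using P by (auto simp: matching_def)
  then obtain x y where xy: "(e, y) \<in># P" "(x, e) \<in># P" by auto
  \<comment> \<open>The two pairs are different elements of \<open>P\<close>: if they coincided,
    they would equal \<open>(e, e)\<close>.\<close>
  then obtain Q where "P = add_mset (e, y) (add_mset (x, e) Q)"
    using False by (metis insert_noteq_member multi_member_split prod.inject)
  then show ?thesis using P powr_triangle[OF \<alpha>, of x y e]
    by (intro exI[of _ "add_mset (x, y) Q"]) (auto simp: matching_def)
qed

text \<open>The partner of \<open>0\<close> moves right: a pair crossing the current partner \<open>w\<close> is
  exchanged with \<open>(0, w)\<close>, replacing two crossing intervals by nested ones.\<close>

lemma matching_reach:
  assumes \<alpha>: "0 < \<alpha>" "\<alpha> < 1"
    and "matching X Y P" "(0, w) \<in># P" "\<forall>z\<in>#X. 0 \<le> z" "\<forall>z\<in>#Y. 0 \<le> z \<and> z \<le> 1"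
    and cross: "\<And>t. 0 \<le> t \<Longrightarrow> t < 1 \<Longrightarrow> num_le t Y < num_le t X"
  shows "\<exists>P'. matching X Y P' \<and> (0, 1) \<in># P' \<and> pairs_cost \<alpha> P' \<le> pairs_cost \<alpha> P"
  using assms(3,4)
proof (induction "size {#z \<in># Y. w < z#}" arbitrary: P w rule: less_induct)
  case less
  have wY: "w \<in># Y" using less.prems by (force simp: matching_def)
  then have w: "0 \<le> w" "w \<le> 1" using assms by auto
  show ?case
  proof (cases "w = 1")
    case True
    then show ?thesis using less.prems by auto
  next
    case False
    then have "num_le w (image_mset snd P) < num_le w (image_mset fst P)"
      using cross[of w] w less.prems by (auto simp: matching_def)
    then obtain x y where xy: "(x, y) \<in># P" "x \<le> w" "w < y" by (rule crossing_pair)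
    \<comment> \<open>The pair \<open>(x, y)\<close> differs from \<open>(0, w)\<close> because
      \<open>w < y\<close>, so both can be split off.\<close>
    obtain Q where Q: "P = add_mset (0, w) (add_mset (x, y) Q)"
      using xy less.prems by (metis insert_noteq_member multi_member_split prod.inject less_irrefl)
    let ?P = "add_mset (0, y) (add_mset (x, w) Q)"
    have yY: "y \<in># Y" and x: "0 \<le> x" using less.prems Q assms by (auto simp: matching_def)
    have "size {#z \<in># Y. y < z#} < size {#z \<in># Y. w < z#}"
      using yY xy by (intro size_filter_greater_less)
    moreover have "matching X Y ?P" using less.prems Q by (auto simp: matching_def)
    ultimately obtain P' where "matching X Y P'" "(0, 1) \<in># P'" "pairs_cost \<alpha> P' \<le> pairs_cost \<alpha> ?P"
      using less.hyps[of y ?P] by auto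
    moreover have "pairs_cost \<alpha> ?P \<le> pairs_cost \<alpha> P"
      using powr_uncross[OF \<alpha>, of 0 x w y] xy x Q by simp
    ultimately show ?thesis by (meson order_trans)
  qed
qed

text \<open>Once \<open>matching_reach\<close> has produced the pair \<open>(0, 1)\<close>, dropping
  it can only lower the cost. The \<open>Suc\<close> counts the \<open>0\<close> to be removed; the
  \<open>1\<close> is not counted for \<open>t < 1\<close>.\<close>

lemma matching_remove_opposite:
  assumes \<alpha>: "0 < \<alpha>" "\<alpha> < 1"
    and P: "matching (add_mset 0 X) (add_mset 1 Y) P"
    and "\<forall>z\<in>#X. 0 \<le> z" "\<forall>z\<in>#Y. 0 \<le> z \<and> z \<le> 1"
    and "\<And>t. 0 \<le> t \<Longrightarrow> t < 1 \<Longrightarrow> num_le t Y < Suc (num_le t X)"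
  shows "\<exists>P'. matching X Y P' \<and> pairs_cost \<alpha> P' \<le> pairs_cost \<alpha> P"
proof -
  have "0 \<in># image_mset fst P" using P by (auto simp: matching_def)
  then obtain w where "(0, w) \<in># P" by auto
  then obtain P' where P': "matching (add_mset 0 X) (add_mset 1 Y) P'" "(0, 1) \<in># P'"
      "pairs_cost \<alpha> P' \<le> pairs_cost \<alpha> P"
    using matching_reach[OF \<alpha> P, of w] assms(4-6) by auto
  then obtain Q where "P' = add_mset (0, 1) Q" by (auto dest: multi_member_split)
  then show ?thesis using P' by (intro exI[of _ Q]) (auto simp: matching_def)
qed

text \<open>Nonempty multisets over \<open>{0, 1}\<close> without a common element are each
  constant, with opposite values.\<close>

lemma two_valued_mset_cases:
  assumes "set_mset U \<subseteq> {0, 1::real}" "set_mset V \<subseteq> {0, 1}" "size U = m" "size V = m" "0 < m"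
  obtains (common) e U' V' where "U = add_mset e U'" "V = add_mset e V'"
  | (left) "U = replicate_mset m 0" "V = replicate_mset m 1"
  | (right) "U = replicate_mset m 1" "V = replicate_mset m 0"
proof (cases "set_mset U \<inter> set_mset V = {}")
  case False
  then show ?thesis using common by (metis disjoint_iff multi_member_split)
next
  case True
  have "U \<noteq> {#}" "V \<noteq> {#}" using assms by auto
  then have "set_mset U \<noteq> {}" "set_mset V \<noteq> {}" by auto
  with True assms(1,2) have "set_mset U = {0} \<and> set_mset V = {1} \<or> set_mset U = {1} \<and> set_mset V = {0}"
    by blast
  moreover have rep: "W = replicate_mset m z" if "set_mset W = {z}" "size W = m" for W :: "real multiset" and z
    using that by (metis order_refl set_mset_subset_singletonD)
  ultimately show ?thesis
    using left right rep[OF _ assms(3)] rep[OF _ assms(4)] by blast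
qed

text \<open>If no boundary point is shared, one side holds \<open>m\<close> copies of
  \<open>0\<close>, which count at every \<open>t\<close> in \<open>[0, 1)\<close>, and the other
  \<open>m\<close> copies of \<open>1\<close>, which never do. Thus \<open>YX\<close> gives the
  crossing condition in case \<open>left\<close>, and \<open>XY\<close> gives it in case
  \<open>right\<close> after swapping the families.\<close>

lemma matching_reduce_step:
  assumes \<alpha>: "0 < \<alpha>" "\<alpha> < 1"
    and X: "set_mset X \<subseteq> {0..1}" and Y: "set_mset Y \<subseteq> {0..1}"
    and UV: "set_mset U \<subseteq> {0, 1}" "set_mset V \<subseteq> {0, 1}" "size U = m" "size V = m" "0 < m"
    and P: "matching (X + U) (Y + V) P"
    and XY: "\<And>t. 0 \<le> t \<Longrightarrow> t < 1 \<Longrightarrow> num_le t X < num_le t Y + m"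
    and YX: "\<And>t. 0 \<le> t \<Longrightarrow> t < 1 \<Longrightarrow> num_le t Y < num_le t X + m"
  shows "\<exists>U' V' P'. set_mset U' \<subseteq> {0, 1} \<and> set_mset V' \<subseteq> {0, 1} \<and> size U' = m - 1 \<and>
           size V' = m - 1 \<and> matching (X + U') (Y + V') P' \<and> pairs_cost \<alpha> P' \<le> pairs_cost \<alpha> P"
  using UV
proof (cases rule: two_valued_mset_cases)
  case (common e U' V')
  then obtain P' where "matching (X + U') (Y + V') P'" "pairs_cost \<alpha> P' \<le> pairs_cost \<alpha> P"
    using matching_remove_common[OF \<alpha>, of e "X + U'" "Y + V'"] P by auto
  then show ?thesis using common UV by (intro exI[of _ U'] exI[of _ V'] exI[of _ P']) auto
next
  case left
  define k where "k = m - 1"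
  have m: "m = Suc k" using UV k_def by simp
  have "matching (add_mset 0 (X + replicate_mset k 0)) (add_mset 1 (Y + replicate_mset k 1)) P"
    using P left m by simp
  moreover have "\<forall>z\<in>#X + replicate_mset k 0. 0 \<le> z" "\<forall>z\<in>#Y + replicate_mset k 1. 0 \<le> z \<and> z \<le> 1"
    using X Y by auto
  moreover have "num_le t (Y + replicate_mset k 1) < Suc (num_le t (X + replicate_mset k 0))"
    if "0 \<le> t" "t < 1" for t
    using YX[OF that] that m by simp
  ultimately
  obtain P' where "matching (X + replicate_mset k 0) (Y + replicate_mset k 1) P'"
      "pairs_cost \<alpha> P' \<le> pairs_cost \<alpha> P"
    using matching_remove_opposite[OF \<alpha>, of "X + replicate_mset k 0" "Y + replicate_mset k 1"] by blast
  then show ?thesis using m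
    by (intro exI[of _ "replicate_mset k 0"] exI[of _ "replicate_mset k 1"] exI[of _ P']) auto
next
  case right
  define k where "k = m - 1"
  have m: "m = Suc k" using UV k_def by simp
  have "matching (add_mset 0 (Y + replicate_mset k 0)) (add_mset 1 (X + replicate_mset k 1))
      (image_mset prod.swap P)"
    using matching_flip(1)[OF P] right m by simp
  moreover have "\<forall>z\<in>#Y + replicate_mset k 0. 0 \<le> z" "\<forall>z\<in>#X + replicate_mset k 1. 0 \<le> z \<and> z \<le> 1"
    using X Y by auto
  moreover have "num_le t (X + replicate_mset k 1) < Suc (num_le t (Y + replicate_mset k 0))"
    if "0 \<le> t" "t < 1" for t
    using XY[OF that] that m by simp
  ultimately
  obtain P' where "matching (Y + replicate_mset k 0) (X + replicate_mset k 1) P'"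
      "pairs_cost \<alpha> P' \<le> pairs_cost \<alpha> (image_mset prod.swap P)"
    using matching_remove_opposite[OF \<alpha>, of "Y + replicate_mset k 0" "X + replicate_mset k 1"] by blast
  then show ?thesis using m matching_flip(1)[of "Y + replicate_mset k 0" "X + replicate_mset k 1" P']
    by (intro exI[of _ "replicate_mset k 1"] exI[of _ "replicate_mset k 0"]
          exI[of _ "image_mset prod.swap P'"]) (auto simp: matching_flip(2))
qed

section \<open>Pair multisets and permutations\<close>

lemma image_mset_permutes:
  assumes "\<sigma> permutes A"
  shows "image_mset (\<lambda>i. f (\<sigma> i)) (mset_set A) = image_mset f (mset_set A)"
proof -
  have "image_mset (\<lambda>i. f (\<sigma> i)) (mset_set A) = image_mset f (image_mset \<sigma> (mset_set A))"
    by (simp add: multiset.map_comp comp_def)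
  also have "image_mset \<sigma> (mset_set A) = mset_set A"
    using assms by (simp add: image_mset_mset_set permutes_image permutes_inj_on)
  finally show ?thesis .
qed

text \<open>Used to turn multisets back into indexed families. Lists are indexed from
  \<open>0\<close> and families from \<open>1\<close>, hence the shift \<open>i - 1\<close>.\<close>

lemma obtain_family:
  obtains u :: "nat \<Rightarrow> 'a" where "image_mset u (mset_set {1..size U}) = U"
proof -
  obtain us where us: "U = mset us" by (metis ex_mset)
  have "us = map (\<lambda>i. us ! (i - 1)) [1..<Suc (length us)]"
    by (rule nth_equalityI) (auto simp del: upt_Suc)
  then have "mset us = image_mset (\<lambda>i. us ! (i - 1)) (mset [1..<Suc (length us)])"
    by (metis mset_map)
  then show ?thesis using that us
    by (metis mset_upt atLeastLessThanSuc_atLeastAtMost size_mset)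
qed

text \<open>Enumerating \<open>P\<close> presents its coordinates as rearrangements of
  \<open>x\<close> and \<open>y\<close> by permutations \<open>s\<close> and \<open>t\<close>;
  reindexing by \<open>s\<close> leaves the single permutation
  \<open>t \<circ> inv s\<close>.\<close>

lemma matching_cost_le:
  assumes P: "matching (image_mset x (mset_set {1..N})) (image_mset y (mset_set {1..N})) P"
  shows "matching_cost \<alpha> N x y \<le> pairs_cost \<alpha> P"
proof -
  have "size (image_mset fst P) = N" using P by (simp add: matching_def)
  then obtain p where psp: "P = image_mset p (mset_set {1..N})" by (metis obtain_family size_image_mset)
  have "image_mset (\<lambda>i. fst (p i)) (mset_set {1..N}) = image_mset x (mset_set {1..N})"
    using P psp by (simp add: matching_def multiset.map_comp comp_def)
  then obtain s where s: "s permutes {1..N}" "\<forall>i\<in>{1..N}. fst (p i) = x (s i)"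
    by (rule image_mset_eq_implies_permutes[OF finite_atLeastAtMost])
  have "image_mset (\<lambda>i. snd (p i)) (mset_set {1..N}) = image_mset y (mset_set {1..N})"
    using P psp by (simp add: matching_def multiset.map_comp comp_def)
  then obtain t where t: "t permutes {1..N}" "\<forall>i\<in>{1..N}. snd (p i) = y (t i)"
    by (rule image_mset_eq_implies_permutes[OF finite_atLeastAtMost])
  have "pairs_cost \<alpha> P = (\<Sum>i\<in>{1..N}. \<bar>fst (p i) - snd (p i)\<bar> powr \<alpha>)"
    by (simp add: psp pairs_cost_def case_prod_unfold multiset.map_comp comp_def sum_unfold_sum_mset)
  also have "\<dots> = (\<Sum>i\<in>{1..N}. \<bar>x (s i) - y ((t \<circ> inv s) (s i))\<bar> powr \<alpha>)"
    using s t by (intro sum.cong) (auto simp: permutes_inverses)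
  also have "\<dots> = (\<Sum>i\<in>{1..N}. \<bar>x i - y ((t \<circ> inv s) i)\<bar> powr \<alpha>)"
    using sum.permute[OF s(1), of "\<lambda>i. \<bar>x i - y ((t \<circ> inv s) i)\<bar> powr \<alpha>"] by (simp add: comp_def)
  finally have "pairs_cost \<alpha> P = (\<Sum>i\<in>{1..N}. \<bar>x i - y ((t \<circ> inv s) i)\<bar> powr \<alpha>)" .
  moreover have "t \<circ> inv s permutes {1..N}"
    using s t by (intro permutes_compose permutes_inv)
  ultimately have "pairs_cost \<alpha> P \<in> (\<lambda>\<sigma>. \<Sum>i = 1..N. \<bar>x i - y (\<sigma> i)\<bar> powr \<alpha>) ` {\<sigma>. \<sigma> permutes {1..N}}"
    by blast
  then show ?thesis unfolding matching_cost_def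
    by (intro Min_le finite_imageI finite_permutations finite_atLeastAtMost)
qed

lemma matching_cost_attained:
  obtains P where "matching (image_mset x (mset_set {1..N})) (image_mset y (mset_set {1..N})) P"
    "pairs_cost \<alpha> P = matching_cost \<alpha> N x y"
proof -
  let ?f = "\<lambda>\<sigma>. \<Sum>i = 1..N. \<bar>x i - y (\<sigma> i)\<bar> powr \<alpha>"
  have "matching_cost \<alpha> N x y \<in> ?f ` {\<sigma>. \<sigma> permutes {1..N}}"
    unfolding matching_cost_def
    by (intro Min_in finite_imageI finite_permutations) (auto intro: permutes_id)
  then obtain \<sigma> where s: "\<sigma> permutes {1..N}" "matching_cost \<alpha> N x y = ?f \<sigma>" by auto
  let ?P = "image_mset (\<lambda>i. (x i, y (\<sigma> i))) (mset_set {1..N})"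
  have "matching (image_mset x (mset_set {1..N})) (image_mset y (mset_set {1..N})) ?P"
    using image_mset_permutes[OF s(1), of y] by (simp add: matching_def multiset.map_comp comp_def)
  moreover have "pairs_cost \<alpha> ?P = matching_cost \<alpha> N x y"
    by (simp add: s pairs_cost_def multiset.map_comp comp_def sum_unfold_sum_mset)
  ultimately show ?thesis by (rule that)
qed

subsection \<open>Tours\<close>

text \<open>A tour is a cyclic list of labelled points in which the labels alternate: \<open>True\<close> marks
  the points of the first family, \<open>False\<close> those of the second. In this form a tour may be
  reversed and rotated freely.\<close>

definition labelled :: "real multiset \<Rightarrow> real multiset \<Rightarrow> (bool \<times> real) multiset" where
  "labelled X Y = image_mset (Pair True) X + image_mset (Pair False) Y"

definition alternating :: "(bool \<times> real) list \<Rightarrow> bool" where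
  "alternating = successively (\<lambda>p q. fst p \<noteq> fst q)"

lemma alternating_simps [simp]:
  "alternating []"
  "alternating (p # L) \<longleftrightarrow> L = [] \<or> fst p \<noteq> fst (hd L) \<and> alternating L"
  "alternating (A @ B) \<longleftrightarrow>
     alternating A \<and> alternating B \<and> (A = [] \<or> B = [] \<or> fst (last A) \<noteq> fst (hd B))"
  "alternating (rev L) \<longleftrightarrow> alternating L"
  "alternating (map (apfst Not) L) \<longleftrightarrow> alternating L"
  by (auto simp: alternating_def successively_Cons successively_append_iff successively_map
      elim!: successively_mono)

definition tour :: "real multiset \<Rightarrow> real multiset \<Rightarrow> (bool \<times> real) list \<Rightarrow> bool" where
  "tour X Y L \<longleftrightarrow> mset L = labelled X Y \<and> L \<noteq> [] \<and>
     alternating L \<and> fst (last L) \<noteq> fst (hd L)"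

definition step_cost :: "real \<Rightarrow> bool \<times> real \<Rightarrow> bool \<times> real \<Rightarrow> real" where
  "step_cost \<alpha> p q = \<bar>snd p - snd q\<bar> powr \<alpha>"

fun walk_cost :: "real \<Rightarrow> (bool \<times> real) list \<Rightarrow> real" where
  "walk_cost \<alpha> (p # q # L) = step_cost \<alpha> p q + walk_cost \<alpha> (q # L)"
| "walk_cost \<alpha> L = 0"

definition cycle_cost :: "real \<Rightarrow> (bool \<times> real) list \<Rightarrow> real" where
  "cycle_cost \<alpha> L = walk_cost \<alpha> L + step_cost \<alpha> (last L) (hd L)"

lemma step_cost_commute: "step_cost \<alpha> p q = step_cost \<alpha> q p"
  by (simp add: step_cost_def abs_minus_commute)

lemma step_cost_triangle:
  "0 < \<alpha> \<Longrightarrow> \<alpha> < 1 \<Longrightarrow> step_cost \<alpha> p r \<le> step_cost \<alpha> p q + step_cost \<alpha> q r"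
  unfolding step_cost_def by (rule powr_triangle)

lemma walk_cost_Cons:
  "L \<noteq> [] \<Longrightarrow> walk_cost \<alpha> (p # L) = step_cost \<alpha> p (hd L) + walk_cost \<alpha> L"
  by (cases L) auto

lemma walk_cost_append:
  "A \<noteq> [] \<Longrightarrow> B \<noteq> [] \<Longrightarrow>
    walk_cost \<alpha> (A @ B) = walk_cost \<alpha> A + step_cost \<alpha> (last A) (hd B) + walk_cost \<alpha> B"
  by (induction \<alpha> A rule: walk_cost.induct) (auto simp: walk_cost_Cons)

lemma walk_cost_rev: "walk_cost \<alpha> (rev L) = walk_cost \<alpha> L"
proof (induction L)
  case (Cons p L)
  then show ?case
    by (cases "L = []") (auto simp: walk_cost_append walk_cost_Cons last_rev step_cost_commute)
qed simp

lemma tour_rotate: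
  "tour X Y (A @ B) \<longleftrightarrow> tour X Y (B @ A)"
  "cycle_cost \<alpha> (A @ B) = cycle_cost \<alpha> (B @ A)"
  by (cases "A = [] \<or> B = []";
      auto simp: tour_def cycle_cost_def walk_cost_append union_commute)+

text \<open>Toggling the labels exchanges the roles of the families; this reduces case
  \<open>right\<close> of the tour reduction to case \<open>left\<close>.\<close>

lemma tour_flip:
  assumes "tour X Y L"
  shows "tour Y X (map (apfst Not) L)" "cycle_cost \<alpha> (map (apfst Not) L) = cycle_cost \<alpha> L"
proof -
  have "image_mset (apfst Not) (labelled X Y) = labelled Y X"
    by (simp add: labelled_def multiset.map_comp comp_def)
  then show "tour Y X (map (apfst Not) L)"
    using assms by (auto simp: tour_def last_map hd_map)
  have "walk_cost \<alpha> (map (apfst Not) L) = walk_cost \<alpha> L"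
    by (induction \<alpha> L rule: walk_cost.induct) (auto simp: step_cost_def)
  then show "cycle_cost \<alpha> (map (apfst Not) L) = cycle_cost \<alpha> L"
    using assms by (simp add: cycle_cost_def tour_def last_map hd_map step_cost_def)
qed

lemma tour_rotate_to:
  assumes "tour X Y L" "p \<in># labelled X Y"
  obtains R where "tour X Y (p # R)" "cycle_cost \<alpha> (p # R) = cycle_cost \<alpha> L"
proof -
  have "p \<in> set L" using assms by (metis set_mset_mset tour_def)
  then obtain A B where L: "L = A @ p # B" by (meson split_list)
  show ?thesis
    using that[of "B @ A"] assms(1) tour_rotate(1)[of X Y A "p # B"]
      tour_rotate(2)[of \<alpha> A "p # B"] unfolding L by simp
qed

lemma labelled_add_mset [simp]:
  "labelled (add_mset a X) Y = add_mset (True, a) (labelled X Y)"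
  "labelled X (add_mset b Y) = add_mset (False, b) (labelled X Y)"
  by (auto simp: labelled_def)

lemma labelled_eq_empty [simp]: "labelled X Y = {#} \<longleftrightarrow> X = {#} \<and> Y = {#}"
  by (auto simp: labelled_def)

text \<open>Filtering by label recovers each family.\<close>

lemma labelled_inject: "labelled X Y = labelled X' Y' \<Longrightarrow> X = X' \<and> Y = Y'"
proof -
  have "image_mset snd (filter_mset fst (labelled X Y)) = X"
    "image_mset snd (filter_mset (Not \<circ> fst) (labelled X Y)) = Y" for X Y
    by (auto simp: labelled_def filter_mset_image_mset multiset.map_comp comp_def)
  then show "labelled X Y = labelled X' Y' \<Longrightarrow> X = X' \<and> Y = Y'" by metis
qed

text \<open>The edge from \<open>last Q\<close> to \<open>hd Q\<close> bypasses both points by two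
  triangle inequalities. Tours are nonempty, and \<open>X \<noteq> {#}\<close> ensures that
  \<open>Q\<close> is.\<close>

lemma tour_remove_adjacent:
  assumes \<alpha>: "0 < \<alpha>" "\<alpha> < 1"
    and L: "tour (add_mset a X) (add_mset b Y) ((True, a) # (False, b) # Q)" and "X \<noteq> {#}"
  shows "tour X Y Q" "cycle_cost \<alpha> Q \<le> cycle_cost \<alpha> ((True, a) # (False, b) # Q)"
proof -
  have m: "mset Q = labelled X Y" using L by (simp add: tour_def)
  then have Q: "Q \<noteq> []" using \<open>X \<noteq> {#}\<close> by auto
  then show "tour X Y Q" using L m
    by (auto simp: tour_def)
  show "cycle_cost \<alpha> Q \<le> cycle_cost \<alpha> ((True, a) # (False, b) # Q)"
    using Q step_cost_triangle[OF \<alpha>, of "last Q" "hd Q" "(True, a)"]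
      step_cost_triangle[OF \<alpha>, of "(True, a)" "hd Q" "(False, b)"]
    by (simp add: cycle_cost_def walk_cost_Cons)
qed

text \<open>Of the two arcs left by removing both copies of \<open>e\<close>, one is reversed before they are
  glued, so that the labels still alternate.\<close>

lemma tour_remove_common:
  assumes \<alpha>: "0 < \<alpha>" "\<alpha> < 1"
    and L: "tour (add_mset e X) (add_mset e Y) L" and X: "X \<noteq> {#}"
  shows "\<exists>L'. tour X Y L' \<and> cycle_cost \<alpha> L' \<le> cycle_cost \<alpha> L"
proof -
  obtain R where R: "tour (add_mset e X) (add_mset e Y) ((True, e) # R)"
      "cycle_cost \<alpha> ((True, e) # R) = cycle_cost \<alpha> L"
    using tour_rotate_to[OF L, of "(True, e)"] by auto
  have mR: "mset R = add_mset (False, e) (labelled X Y)" using R by (simp add: tour_def)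
  then have "(False, e) \<in> set R" by (metis set_mset_mset union_single_eq_member)
  then obtain P Q where PQ: "R = P @ (False, e) # Q" by (meson split_list)
  have m: "mset P + mset Q = labelled X Y" using mR PQ by simp
  show ?thesis
  \<comment> \<open>An empty arc means that the two copies of \<open>e\<close> are neighbours on the
    cycle.\<close>
  proof (cases "P = [] \<or> Q = []")
    case True
    then obtain L1 where L1: "tour (add_mset e X) (add_mset e Y) ((True, e) # (False, e) # L1)"
        "cycle_cost \<alpha> ((True, e) # (False, e) # L1) = cycle_cost \<alpha> L"
    proof
      assume "P = []"
      then show ?thesis using that R PQ by simp
    next
      assume Q: "Q = []"
      have P: "P \<noteq> []" using m Q X by auto
      \<comment> \<open>Here \<open>(False, e)\<close> precedes \<open>(True, e)\<close> cyclically;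
        travelling in the opposite direction makes it the successor.\<close>
      have *: "tour (add_mset e X) (add_mset e Y) ((True, e) # (False, e) # rev P)"
        using R P unfolding PQ Q
        by (auto simp: tour_def last_rev hd_rev)
      have "cycle_cost \<alpha> ((True, e) # (False, e) # rev P) = cycle_cost \<alpha> ((True, e) # R)"
        using P unfolding PQ Q
        by (simp add: cycle_cost_def walk_cost_Cons walk_cost_append walk_cost_rev last_rev hd_rev
              step_cost_commute)
      then show ?thesis using that * R by simp
    qed
    then show ?thesis using tour_remove_adjacent[OF \<alpha> L1(1) X] by auto
  next
    case False
    then have ne: "P \<noteq> []" "Q \<noteq> []" by auto
    have "tour X Y (P @ rev Q)"
      using R(1) m ne unfolding PQ
      by (auto simp: tour_def last_rev hd_rev)
    \<comment> \<open>Each new edge, \<open>last P\<close> to \<open>last Q\<close> and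
      \<open>hd Q\<close> to \<open>hd P\<close>, replaces one edge at either copy of
      \<open>e\<close>. Both copies lie at the same point, so the triangle inequality
      applies.\<close>
    moreover have "cycle_cost \<alpha> (P @ rev Q) \<le> cycle_cost \<alpha> ((True, e) # R)"
      using ne step_cost_triangle[OF \<alpha>, of "last P" "last Q" "(False, e)"]
        step_cost_triangle[OF \<alpha>, of "hd Q" "hd P" "(False, e)"]
        step_cost_commute[of \<alpha> "hd Q" "(False, e)"] step_cost_commute[of \<alpha> "last Q" "(False, e)"]
      unfolding PQ
      by (simp add: cycle_cost_def walk_cost_Cons walk_cost_append walk_cost_rev last_rev hd_rev
            step_cost_def)
    ultimately show ?thesis using R by auto
  qed
qed

text \<open>Read \<open>R\<close> in blocks \<open>(False, y), (True, x)\<close>. A block without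
  the crossing has \<open>y \<le> t\<close> whenever \<open>x \<le> t\<close>, so dropping it keeps
  the inequality strict. A single leftover point has label \<open>False\<close> and cannot satisfy
  that inequality.\<close>

lemma backward_crossing:
  assumes "mset R = labelled X Y" "alternating R"
    "R \<noteq> []" "\<not> fst (hd R)" "num_le t Y < num_le t X"
  obtains A y x B where "R = A @ (False, y) # (True, x) # B" "x \<le> t" "t < y"
proof -
  have "\<exists>A y x B. R = A @ (False, y) # (True, x) # B \<and> x \<le> t \<and> t < y"
    using assms
  proof (induction "length R" arbitrary: R X Y rule: less_induct)
    case less
    obtain y R1 where R1: "R = (False, y) # R1"
      using less.prems by (cases R) (auto simp: prod_eq_iff)
    show ?case
    proof (cases R1)
      case Nil
      then have "labelled X Y = labelled {#} {#y#}" using less.prems R1 by (simp add: labelled_def)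
      then have "X = {#}" by (metis labelled_inject)
      then show ?thesis using less.prems by simp
    next
      case (Cons p R2)
      then obtain x where R: "R = (False, y) # (True, x) # R2"
        using less.prems R1 by (cases p) auto
      show ?thesis
      proof (cases "x \<le> t \<and> t < y")
        case True
        then show ?thesis using R by blast
      next
        case False
        have "(True, x) \<in># labelled X Y" "(False, y) \<in># labelled X Y"
          using less.prems(1) unfolding R by (metis list.set_intros(1) list.set_intros(2) set_mset_mset)+
        then have "x \<in># X" "y \<in># Y" by (auto simp: labelled_def)
        then obtain X' Y' where XY: "X = add_mset x X'" "Y = add_mset y Y'"
          by (meson multi_member_split)
        have c: "num_le t Y' < num_le t X'"
          using less.prems(5) False XY by (auto split: if_splits)
        have m: "mset R2 = labelled X' Y'" using less.prems(1) R XY by simp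
        have ne: "R2 \<noteq> []" using m c by auto
        have "\<exists>A y x B. R2 = A @ (False, y) # (True, x) # B \<and> x \<le> t \<and> t < y"
          using less.hyps[OF _ m _ ne _ c] less.prems(2) ne R by auto
        then show ?thesis unfolding R by (metis append_Cons)
      qed
    qed
  qed
  then show ?thesis using that by blast
qed

text \<open>As in \<open>matching_reach\<close>, the successor of \<open>0\<close> moves right by 2-opt exchanges. Only an
  edge traversed against the direction of \<open>(0, w)\<close> can be exchanged without splitting
  the tour, and it must not end in \<open>0\<close> itself: hence \<open>X\<close> in the crossing condition does not
  count the point \<open>0\<close>.\<close>

lemma tour_reach:
  assumes \<alpha>: "0 < \<alpha>" "\<alpha> < 1"
    and "tour (add_mset 0 X) Y ((True, 0) # (False, w) # R)"
    and "\<forall>z\<in>#X. 0 \<le> z" "\<forall>z\<in>#Y. 0 \<le> z \<and> z \<le> 1"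
    and cross: "\<And>t. 0 \<le> t \<Longrightarrow> t < 1 \<Longrightarrow> num_le t Y < num_le t X"
  shows "\<exists>R'. tour (add_mset 0 X) Y ((True, 0) # (False, 1) # R') \<and>
      cycle_cost \<alpha> ((True, 0) # (False, 1) # R') \<le> cycle_cost \<alpha> ((True, 0) # (False, w) # R)"
  using assms(3)
proof (induction "size {#z \<in># Y. w < z#}" arbitrary: R w rule: less_induct)
  case less
  let ?L = "(True, 0) # (False, w) # R"
  have m: "mset ((False, w) # R) = labelled X Y" using less.prems by (simp add: tour_def)
  then have "(False, w) \<in># labelled X Y" by (metis list.set_intros(1) set_mset_mset)
  then have w: "0 \<le> w" "w \<le> 1" using assms by (auto simp: labelled_def)
  show ?case
  proof (cases "w = 1")
    case True
    then show ?thesis using less.prems by auto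
  next
    case False
    then have "num_le w Y < num_le w X" using cross[of w] w by simp
    moreover have "alternating ((False, w) # R)"
      using less.prems by (simp add: tour_def)
    ultimately obtain A y x B where AB: "(False, w) # R = A @ (False, y) # (True, x) # B"
        "x \<le> w" "w < y"
      using backward_crossing[OF m, of w] by (metis fst_conv list.distinct(1) list.sel(1))
    then have A: "A \<noteq> []" "hd A = (False, w)" by (cases A; auto)+
    \<comment> \<open>Reversing the segment \<open>A @ [(False, y)]\<close>, which starts at
      \<open>w\<close>, replaces the edges \<open>0\<close> to \<open>w\<close> and \<open>y\<close>
      to \<open>x\<close> by \<open>0\<close> to \<open>y\<close> and \<open>w\<close> to
      \<open>x\<close>; \<open>A\<close> is nonempty because \<open>w < y\<close>.\<close>
    let ?L' = "(True, 0) # (False, y) # rev A @ (True, x) # B"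
    have L: "?L = (True, 0) # A @ (False, y) # (True, x) # B" using AB by simp
    have "(True, x) \<in># labelled X Y" "(False, y) \<in># labelled X Y"
      unfolding m[symmetric] AB(1) by auto
    then have xy: "0 \<le> x" "y \<in># Y" using assms by (auto simp: labelled_def)
    have "tour (add_mset 0 X) Y ?L'"
      using less.prems A unfolding L
      by (cases B) (auto simp: tour_def last_rev hd_rev add.commute
          split: if_splits)
    moreover have "size {#z \<in># Y. y < z#} < size {#z \<in># Y. w < z#}"
      using xy AB by (intro size_filter_greater_less)
    ultimately obtain R' where "tour (add_mset 0 X) Y ((True, 0) # (False, 1) # R')"
       "cycle_cost \<alpha> ((True, 0) # (False, 1) # R') \<le> cycle_cost \<alpha> ?L'"
      using less.hyps by blast
    moreover have "cycle_cost \<alpha> ?L' \<le> cycle_cost \<alpha> ?L"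
      using powr_uncross[OF \<alpha>, of 0 x w y] xy AB A step_cost_commute[of \<alpha> "last A" "(False, y)"]
      unfolding L
      by (simp add: cycle_cost_def walk_cost_Cons walk_cost_append walk_cost_rev hd_rev last_rev
           step_cost_def abs_minus_commute)
    ultimately show ?thesis by (meson order_trans)
  qed
qed

text \<open>After rotating the tour to start at \<open>0\<close>, \<open>tour_reach\<close> makes
  \<open>0\<close> and \<open>1\<close> neighbours. Unlike in
  \<open>matching_remove_opposite\<close>, the removed \<open>0\<close> is not counted in the
  crossing condition.\<close>

lemma tour_remove_opposite:
  assumes \<alpha>: "0 < \<alpha>" "\<alpha> < 1"
    and L: "tour (add_mset 0 X) (add_mset 1 Y) L" and X: "X \<noteq> {#}"
    and "\<forall>z\<in>#X. 0 \<le> z" "\<forall>z\<in>#Y. 0 \<le> z \<and> z \<le> 1"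
    and "\<And>t. 0 \<le> t \<Longrightarrow> t < 1 \<Longrightarrow> num_le t Y < num_le t X"
  shows "\<exists>L'. tour X Y L' \<and> cycle_cost \<alpha> L' \<le> cycle_cost \<alpha> L"
proof -
  obtain R where R: "tour (add_mset 0 X) (add_mset 1 Y) ((True, 0) # R)"
      "cycle_cost \<alpha> ((True, 0) # R) = cycle_cost \<alpha> L"
    using tour_rotate_to[OF L, of "(True, 0)"] by auto
  obtain w R1 where "R = (False, w) # R1"
    using R(1) by (cases R) (auto simp: tour_def)
  then obtain R' where R': "tour (add_mset 0 X) (add_mset 1 Y) ((True, 0) # (False, 1) # R')"
      "cycle_cost \<alpha> ((True, 0) # (False, 1) # R') \<le> cycle_cost \<alpha> L"
    using tour_reach[OF \<alpha>, of X "add_mset 1 Y" w R1] R assms(5-7) by auto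
  then show ?thesis using tour_remove_adjacent[OF \<alpha> R'(1) X] by auto
qed

text \<open>Only \<open>m - 1\<close> of the \<open>m\<close> copies of \<open>0\<close> count
  towards a crossing. This is the source of the \<open>Suc\<close> in \<open>XY\<close> and
  \<open>YX\<close>, and of the extra \<open>1\<close> in the bound for tours.\<close>

lemma tour_reduce_step:
  assumes \<alpha>: "0 < \<alpha>" "\<alpha> < 1"
    and X: "set_mset X \<subseteq> {0..1}" "X \<noteq> {#}" and Y: "set_mset Y \<subseteq> {0..1}" "Y \<noteq> {#}"
    and UV: "set_mset U \<subseteq> {0, 1}" "set_mset V \<subseteq> {0, 1}" "size U = m" "size V = m" "0 < m"
    and L: "tour (X + U) (Y + V) L"
    and XY: "\<And>t. 0 \<le> t \<Longrightarrow> t < 1 \<Longrightarrow> Suc (num_le t X) < num_le t Y + m"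
    and YX: "\<And>t. 0 \<le> t \<Longrightarrow> t < 1 \<Longrightarrow> Suc (num_le t Y) < num_le t X + m"
  shows "\<exists>U' V' L'. set_mset U' \<subseteq> {0, 1} \<and> set_mset V' \<subseteq> {0, 1} \<and> size U' = m - 1 \<and>
           size V' = m - 1 \<and> tour (X + U') (Y + V') L' \<and> cycle_cost \<alpha> L' \<le> cycle_cost \<alpha> L"
  using UV
proof (cases rule: two_valued_mset_cases)
  case (common e U' V')
  then obtain L' where "tour (X + U') (Y + V') L'" "cycle_cost \<alpha> L' \<le> cycle_cost \<alpha> L"
    using tour_remove_common[OF \<alpha>, of e "X + U'" "Y + V'"] L X by auto
  then show ?thesis using common UV by (intro exI[of _ U'] exI[of _ V'] exI[of _ L']) auto
next
  case left
  define k where "k = m - 1"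
  have m: "m = Suc k" using UV k_def by simp
  have "tour (add_mset 0 (X + replicate_mset k 0)) (add_mset 1 (Y + replicate_mset k 1)) L"
    using L left m by simp
  moreover have "\<forall>z\<in>#X + replicate_mset k 0. 0 \<le> z" "\<forall>z\<in>#Y + replicate_mset k 1. 0 \<le> z \<and> z \<le> 1"
    using X Y by auto
  moreover have "num_le t (Y + replicate_mset k 1) < num_le t (X + replicate_mset k 0)"
    if "0 \<le> t" "t < 1" for t
    using YX[OF that] that m by simp
  ultimately
  obtain L' where "tour (X + replicate_mset k 0) (Y + replicate_mset k 1) L'"
      "cycle_cost \<alpha> L' \<le> cycle_cost \<alpha> L"
    using tour_remove_opposite[OF \<alpha>, of "X + replicate_mset k 0" "Y + replicate_mset k 1"] X Y by blast
  then show ?thesis using m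
    by (intro exI[of _ "replicate_mset k 0"] exI[of _ "replicate_mset k 1"] exI[of _ L']) auto
next
  case right
  define k where "k = m - 1"
  have m: "m = Suc k" using UV k_def by simp
  have "tour (add_mset 0 (Y + replicate_mset k 0)) (add_mset 1 (X + replicate_mset k 1))
      (map (apfst Not) L)"
    using tour_flip(1)[OF L] right m by simp
  moreover have "\<forall>z\<in>#Y + replicate_mset k 0. 0 \<le> z" "\<forall>z\<in>#X + replicate_mset k 1. 0 \<le> z \<and> z \<le> 1"
    using X Y by auto
  moreover have "num_le t (X + replicate_mset k 1) < num_le t (Y + replicate_mset k 0)"
    if "0 \<le> t" "t < 1" for t
    using XY[OF that] that m by simp
  ultimately
  obtain L' where "tour (Y + replicate_mset k 0) (X + replicate_mset k 1) L'"
      "cycle_cost \<alpha> L' \<le> cycle_cost \<alpha> (map (apfst Not) L)"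
    using tour_remove_opposite[OF \<alpha>, of "Y + replicate_mset k 0" "X + replicate_mset k 1"] X Y by blast
  then show ?thesis using m tour_flip[of "Y + replicate_mset k 0" "X + replicate_mset k 1" L']
      tour_flip(2)[OF L]
    by (intro exI[of _ "replicate_mset k 1"] exI[of _ "replicate_mset k 0"]
          exI[of _ "map (apfst Not) L'"]) auto
qed

section \<open>Tours and pairs of permutations\<close>

text \<open>With \<open>a = x \<circ> \<sigma>\<close> and \<open>b = y \<circ> \<tau>\<close> this
  is the tour whose cost \<open>tsp_cost\<close> assigns to
  \<open>(\<sigma>, \<tau>)\<close>.\<close>

definition interleave :: "(nat \<Rightarrow> real) \<Rightarrow> (nat \<Rightarrow> real) \<Rightarrow> nat \<Rightarrow> (bool \<times> real) list" where
  "interleave a b N = concat (map (\<lambda>i. [(True, a i), (False, b i)]) [1..<Suc N])"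

lemma interleave_0: "interleave a b 0 = []"
  by (simp add: interleave_def)

lemma interleave_Suc:
  "interleave a b (Suc N) = interleave a b N @ [(True, a (Suc N)), (False, b (Suc N))]"
  by (simp add: interleave_def)

lemma interleave_ends:
  assumes "0 < N"
  shows "interleave a b N \<noteq> []" "hd (interleave a b N) = (True, a 1)"
    "last (interleave a b N) = (False, b N)"
proof -
  have "interleave a b N \<noteq> [] \<and> hd (interleave a b N) = (True, a 1) \<and>
      last (interleave a b N) = (False, b N)"
    using assms
  proof (induction N rule: nat_induct_non_zero)
    case (Suc N)
    then show ?case by (simp add: interleave_Suc)
  qed (simp add: interleave_def)
  then show "interleave a b N \<noteq> []" "hd (interleave a b N) = (True, a 1)"
    "last (interleave a b N) = (False, b N)" by auto
qed

lemma mset_interleave: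
  "mset (interleave a b N) =
     labelled (image_mset a (mset_set {1..N})) (image_mset b (mset_set {1..N}))"
  by (induction N) (simp_all add: interleave_0 interleave_Suc labelled_def atLeastAtMostSuc_conv)

lemma tour_interleave:
  assumes "0 < N"
  shows "tour (image_mset a (mset_set {1..N})) (image_mset b (mset_set {1..N})) (interleave a b N)"
proof -
  have "alternating (interleave a b N)"
  proof (induction N)
    case (Suc N)
    then show ?case
      by (cases "N = 0") (auto simp: interleave_0 interleave_Suc interleave_ends)
  qed (simp add: interleave_0)
  then show ?thesis using assms by (simp add: tour_def mset_interleave interleave_ends)
qed

lemma cycle_cost_interleave:
  assumes "0 < N"
  shows "cycle_cost \<alpha> (interleave a b N) =
    (\<Sum>i = 1..N. \<bar>a i - b i\<bar> powr \<alpha> + \<bar>b i - a (cyc_suc N i)\<bar> powr \<alpha>)"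
proof -
  \<comment> \<open>The endpoint \<open>z\<close> of the closing edge stays arbitrary: the induction
    uses \<open>z = a (Suc N)\<close>, the conclusion \<open>z = a 1\<close>.\<close>
  have "walk_cost \<alpha> (interleave a b N) + \<bar>b N - z\<bar> powr \<alpha> =
      (\<Sum>i = 1..N. \<bar>a i - b i\<bar> powr \<alpha> + \<bar>b i - (if i = N then z else a (i + 1))\<bar> powr \<alpha>)" for z
    using assms
  proof (induction N arbitrary: z rule: nat_induct_non_zero)
    case 1
    then show ?case by (simp add: interleave_def step_cost_def)
  next
    case (Suc N)
    have "walk_cost \<alpha> (interleave a b (Suc N)) + \<bar>b (Suc N) - z\<bar> powr \<alpha> =
        walk_cost \<alpha> (interleave a b N) + \<bar>b N - a (Suc N)\<bar> powr \<alpha> +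
        (\<bar>a (Suc N) - b (Suc N)\<bar> powr \<alpha> + \<bar>b (Suc N) - z\<bar> powr \<alpha>)"
      using Suc.hyps by (simp add: interleave_Suc walk_cost_append interleave_ends step_cost_def)
    also have "walk_cost \<alpha> (interleave a b N) + \<bar>b N - a (Suc N)\<bar> powr \<alpha> =
        (\<Sum>i = 1..N. \<bar>a i - b i\<bar> powr \<alpha> + \<bar>b i - (if i = N then a (Suc N) else a (i + 1))\<bar> powr \<alpha>)"
      by (rule Suc.IH)
    also have "\<dots> = (\<Sum>i = 1..N. \<bar>a i - b i\<bar> powr \<alpha> +
        \<bar>b i - (if i = Suc N then z else a (i + 1))\<bar> powr \<alpha>)"
      by (intro sum.cong) auto
    finally show ?case by simp
  qed
  from this[of "a 1"] show ?thesis
    using assms by (simp add: cycle_cost_def interleave_ends step_cost_def cyc_suc_def if_distrib)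
qed

text \<open>Alternation from a head labelled \<open>True\<close> forces label \<open>even k\<close>
  at position \<open>k\<close>, and the opposite label at the end makes the length even.\<close>

lemma tour_eq_interleave:
  assumes L: "tour X Y L" and hd: "fst (hd L)"
  obtains a b N where "L = interleave a b N" "0 < N"
proof -
  define N where "N = length L div 2"
  have lab: "fst (L ! k) = even k" if "k < length L" for k
    using that
  proof (induction k)
    case 0
    then show ?case using L hd by (simp add: tour_def hd_conv_nth)
  next
    case (Suc k)
    then show ?case
      using L successively_nth[of _ L k] by (auto simp: tour_def alternating_def)
  qed
  have ne: "L \<noteq> []" using L by (simp add: tour_def)
  then have "\<not> fst (L ! (length L - 1))" using L hd by (simp add: tour_def last_conv_nth)
  then have len: "length L = 2 * N"
    using lab[of "length L - 1"] ne unfolding N_def by (cases "length L") auto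
  \<comment> \<open>List positions start at \<open>0\<close> and family indices at \<open>1\<close>:
    the \<open>i\<close>-th block occupies positions \<open>2 * i - 2\<close> and
    \<open>2 * i - 1\<close>.\<close>
  define a b where "a i = snd (L ! (2 * i - 2))" and "b i = snd (L ! (2 * i - 1))" for i
  have "interleave a b M = map (nth L) [0..<2 * M]" if "M \<le> N" for M
    using that
  proof (induction M)
    case (Suc M)
    have "(True, a (Suc M)) = L ! (2 * M)" "(False, b (Suc M)) = L ! Suc (2 * M)"
      using lab[of "2 * M"] lab[of "Suc (2 * M)"] len Suc.prems
      by (auto simp: a_def b_def prod_eq_iff)
    then show ?case using Suc by (simp add: interleave_Suc)
  qed (simp add: interleave_0)
  then have "interleave a b N = L" using map_nth[of L] by (simp add: len)
  then show ?thesis using that len ne by (metis gr0I interleave_0)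
qed

text \<open>Rotated to start in the first family, the tour is an \<open>interleave\<close>. Its
  labels separate the two families, and equal multisets of values yield the permutations.\<close>

lemma tsp_cost_le:
  assumes L: "tour (image_mset x (mset_set {1..N})) (image_mset y (mset_set {1..N})) L"
  shows "tsp_cost \<alpha> N x y \<le> cycle_cost \<alpha> L"
proof -
  let ?X = "image_mset x (mset_set {1..N})" and ?Y = "image_mset y (mset_set {1..N})"
  have "0 < N" using L by (cases N) (auto simp: tour_def labelled_def)
  then have "(True, x 1) \<in># labelled ?X ?Y" by (auto simp: labelled_def)
  then obtain R where R: "tour ?X ?Y ((True, x 1) # R)"
      "cycle_cost \<alpha> ((True, x 1) # R) = cycle_cost \<alpha> L"
    using tour_rotate_to[OF L] by blast
  obtain a b M where ab: "(True, x 1) # R = interleave a b M"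
    using tour_eq_interleave[OF R(1)] by (metis fst_conv list.sel(1))
  have "labelled (image_mset a (mset_set {1..M})) (image_mset b (mset_set {1..M})) = labelled ?X ?Y"
    using R(1) unfolding ab by (simp add: tour_def mset_interleave)
  from labelled_inject[OF this]
  have X: "image_mset a (mset_set {1..M}) = ?X" and Y: "image_mset b (mset_set {1..M}) = ?Y" by auto
  have M: "M = N" using arg_cong[OF X, of size] by simp
  obtain s where s: "s permutes {1..N}" "\<forall>i\<in>{1..N}. a i = x (s i)"
    using X[unfolded M] by (rule image_mset_eq_implies_permutes[OF finite_atLeastAtMost])
  obtain t where t: "t permutes {1..N}" "\<forall>i\<in>{1..N}. b i = y (t i)"
    using Y[unfolded M] by (rule image_mset_eq_implies_permutes[OF finite_atLeastAtMost])
  have "cycle_cost \<alpha> L = (\<Sum>i = 1..N. \<bar>a i - b i\<bar> powr \<alpha> + \<bar>b i - a (cyc_suc N i)\<bar> powr \<alpha>)"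
    using cycle_cost_interleave[OF \<open>0 < N\<close>] R(2) ab M by simp
  also have "\<dots> = (\<Sum>i = 1..N. \<bar>x (s i) - y (t i)\<bar> powr \<alpha> + \<bar>y (t i) - x (s (cyc_suc N i))\<bar> powr \<alpha>)"
    using s t by (intro sum.cong) (auto simp: cyc_suc_def)
  finally have "cycle_cost \<alpha> L \<in> (\<lambda>(\<sigma>, \<tau>). \<Sum>i = 1..N.
        \<bar>x (\<sigma> i) - y (\<tau> i)\<bar> powr \<alpha> + \<bar>y (\<tau> i) - x (\<sigma> (cyc_suc N i))\<bar> powr \<alpha>)
      ` ({\<sigma>. \<sigma> permutes {1..N}} \<times> {\<tau>. \<tau> permutes {1..N}})"
    using s t by (intro image_eqI[of _ _ "(s, t)"]) auto
  then show ?thesis unfolding tsp_cost_def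
    by (intro Min_le finite_imageI finite_cartesian_product finite_permutations finite_atLeastAtMost)
qed

lemma tsp_cost_attained:
  assumes "0 < N"
  obtains L where "tour (image_mset x (mset_set {1..N})) (image_mset y (mset_set {1..N})) L"
    "cycle_cost \<alpha> L = tsp_cost \<alpha> N x y"
proof -
  let ?f = "\<lambda>(\<sigma>, \<tau>). \<Sum>i = 1..N.
        \<bar>x (\<sigma> i) - y (\<tau> i)\<bar> powr \<alpha> + \<bar>y (\<tau> i) - x (\<sigma> (cyc_suc N i))\<bar> powr \<alpha>"
  let ?S = "{\<sigma>. \<sigma> permutes {1..N}} \<times> {\<tau>. \<tau> permutes {1..N}}"
  have "?S \<noteq> {}" by (auto intro: permutes_id)
  then have "tsp_cost \<alpha> N x y \<in> ?f ` ?S"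
    unfolding tsp_cost_def
    by (intro Min_in finite_imageI finite_cartesian_product finite_permutations) auto
  then obtain \<sigma> \<tau> where st: "\<sigma> permutes {1..N}" "\<tau> permutes {1..N}" "tsp_cost \<alpha> N x y = ?f (\<sigma>, \<tau>)"
    by auto
  let ?L = "interleave (\<lambda>i. x (\<sigma> i)) (\<lambda>i. y (\<tau> i)) N"
  have "tour (image_mset x (mset_set {1..N})) (image_mset y (mset_set {1..N})) ?L"
    using tour_interleave[OF assms, of "\<lambda>i. x (\<sigma> i)" "\<lambda>i. y (\<tau> i)"] st
    by (simp add: image_mset_permutes)
  moreover have "cycle_cost \<alpha> ?L = tsp_cost \<alpha> N x y"
    using st cycle_cost_interleave[OF assms] by simp
  ultimately show ?thesis by (rule that)
qed

subsection \<open>Removing boundary points\<close>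

text \<open>Concatenation becomes a sum of multisets: the last \<open>m\<close> indices are
  \<open>{1..m}\<close> shifted by \<open>n\<close>.\<close>

lemma image_mset_concat_fam:
  "image_mset (concat_fam n x u) (mset_set {1..n + m}) =
     image_mset x (mset_set {1..n}) + image_mset u (mset_set {1..m})"
proof -
  have "{1..n + m} = {1..n} \<union> (\<lambda>j. j + n) ` {1..m}"
    using image_add_atLeastAtMost'[of n 1 m] by (auto simp: add.commute)
  then have "mset_set {1..n + m} = mset_set {1..n} + image_mset (\<lambda>j. j + n) (mset_set {1..m})"
    by (subst image_mset_mset_set) (auto intro!: mset_set_Union)
  moreover have "image_mset (concat_fam n x u) (mset_set {1..n}) = image_mset x (mset_set {1..n})"
    by (intro image_mset_cong) (auto simp: concat_fam_def)
  moreover have "image_mset (\<lambda>j. concat_fam n x u (j + n)) (mset_set {1..m}) =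
      image_mset u (mset_set {1..m})"
    by (intro image_mset_cong) (auto simp: concat_fam_def)
  ultimately show ?thesis by (simp add: multiset.map_comp comp_def)
qed

lemma num_le_family: "real (num_le t (image_mset x (mset_set {1..n}))) = count_le n x t"
  by (induction n) (auto simp: num_le_def count_le_def atLeastAtMostSuc_conv)

text \<open>Iterates a step that lowers the number \<open>m\<close> of boundary points down to the bound \<open>K\<close>;
  \<open>Z\<close> and \<open>c\<close> stand for the admissible configurations and their cost.\<close>

lemma boundary_reduction:
  fixes K :: real and Z :: "real multiset \<Rightarrow> real multiset \<Rightarrow> 'p \<Rightarrow> bool" and c :: "'p \<Rightarrow> real"
  assumes "0 \<le> K"
    and step: "\<And>U V P m. set_mset U \<subseteq> {0, 1} \<Longrightarrow> set_mset V \<subseteq> {0, 1} \<Longrightarrow> size U = m \<Longrightarrow> size V = m \<Longrightarrow>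
      K < m \<Longrightarrow> Z U V P \<Longrightarrow>
      \<exists>U' V' P'. set_mset U' \<subseteq> {0, 1} \<and> set_mset V' \<subseteq> {0, 1} \<and> size U' = m - 1 \<and>
        size V' = m - 1 \<and> Z U' V' P' \<and> c P' \<le> c P"
    and attained: "\<And>m u v. \<exists>P. Z (image_mset u (mset_set {1..m})) (image_mset v (mset_set {1..m})) P \<and>
      c P = cost m u v"
    and le: "\<And>m u v P. Z (image_mset u (mset_set {1..m})) (image_mset v (mset_set {1..m})) P \<Longrightarrow>
      cost m u v \<le> c P"
    and nonneg: "\<And>m u v. 0 \<le> cost m u v"
  shows "(INF (m, u, v) \<in> boundary_fams UNIV. cost m u v) =
    (INF (m, u, v) \<in> boundary_fams {m. real m \<le> K}. cost m u v)"
proof (rule antisym)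
  have ne: "boundary_fams {m. real m \<le> K} \<noteq> {}"
    using \<open>0 \<le> K\<close> by (auto simp: boundary_fams_def intro!: exI[of _ "0::nat"])
  \<comment> \<open>Comparing real infima requires boundedness below, which nonnegative costs
    provide.\<close>
  have bdd: "bdd_below ((\<lambda>(m, u, v). cost m u v) ` A)" for A
    using nonneg by (auto intro!: bdd_belowI)
  show "(INF (m, u, v) \<in> boundary_fams UNIV. cost m u v) \<le>
      (INF (m, u, v) \<in> boundary_fams {m. real m \<le> K}. cost m u v)"
    by (rule cINF_superset_mono[OF ne bdd]) (auto simp: boundary_fams_def)
  have red: "\<exists>U' V' P'. set_mset U' \<subseteq> {0, 1} \<and> set_mset V' \<subseteq> {0, 1} \<and> real (size U') \<le> K \<and>
      size V' = size U' \<and> Z U' V' P' \<and> c P' \<le> c P"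
    if "set_mset U \<subseteq> {0, 1}" "set_mset V \<subseteq> {0, 1}" "size U = m" "size V = m" "Z U V P" for U V P m
    using that
  proof (induction m arbitrary: U V P rule: less_induct)
    case (less m)
    show ?case
    proof (cases "real m \<le> K")
      case True
      then show ?thesis using less.prems by (intro exI[of _ U] exI[of _ V] exI[of _ P]) auto
    next
      case False
      then have "K < m" by simp
      from step[OF less.prems(1-4) this less.prems(5)]
      obtain U' V' P' where P': "set_mset U' \<subseteq> {0, 1}" "set_mset V' \<subseteq> {0, 1}" "size U' = m - 1"
        "size V' = m - 1" "Z U' V' P'" "c P' \<le> c P" by blast
      \<comment> \<open>Since \<open>0 \<le> K < m\<close>, the truncated subtraction really
        decreases.\<close>
      have "m - 1 < m" using False \<open>0 \<le> K\<close> by (cases m) auto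
      from less.IH[OF this P'(1-5)] P'(6) show ?thesis by (meson order_trans)
    qed
  qed
  have "\<exists>q\<in>boundary_fams {m. real m \<le> K}. (case q of (m, u, v) \<Rightarrow> cost m u v) \<le> cost m u v"
    if "(m, u, v) \<in> boundary_fams UNIV" for m u v
  proof -
    obtain P where P: "Z (image_mset u (mset_set {1..m})) (image_mset v (mset_set {1..m})) P"
      "c P = cost m u v" using attained by blast
    have "set_mset (image_mset u (mset_set {1..m})) \<subseteq> {0, 1}"
      "set_mset (image_mset v (mset_set {1..m})) \<subseteq> {0, 1}"
      using that by (auto simp: boundary_fams_def)
    from red[OF this _ _ P(1), of m]
    obtain U' V' P' where P': "set_mset U' \<subseteq> {0, 1}" "set_mset V' \<subseteq> {0, 1}" "real (size U') \<le> K"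
      "size V' = size U'" "Z U' V' P'" "c P' \<le> c P" by auto
    \<comment> \<open>The reduced multisets become families again, both indexed by
      \<open>{1..size U'}\<close>.\<close>
    obtain u' where u': "image_mset u' (mset_set {1..size U'}) = U'" by (rule obtain_family)
    obtain v' where v': "image_mset v' (mset_set {1..size U'}) = V'"
      using obtain_family[of V'] P'(4) by metis
    have "u' ` {1..size U'} = set_mset U'" "v' ` {1..size U'} = set_mset V'"
      using arg_cong[OF u', of set_mset] arg_cong[OF v', of set_mset] by simp_all
    then have "(size U', u', v') \<in> boundary_fams {m. real m \<le> K}"
      using P'(1-3) unfolding boundary_fams_def by blast
    moreover have "cost (size U') u' v' \<le> cost m u v"
      using le[of u' "size U'" v' P'] P P' u' v' by simp
    ultimately show ?thesis by (intro bexI[of _ "(size U', u', v')"]) auto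
  qed
  then show "(INF (m, u, v) \<in> boundary_fams {m. real m \<le> K}. cost m u v) \<le>
      (INF (m, u, v) \<in> boundary_fams UNIV. cost m u v)"
    using ne by (intro cINF_mono bdd) (auto simp: boundary_fams_def)
qed

text \<open>All points are positive, so the difference of the counts vanishes at \<open>0\<close>;
  its value at \<open>t\<close> is the increment from \<open>s = 0\<close>. The bound
  \<open>2 * real n\<close> makes the supremum a genuine upper bound.\<close>

lemma abs_count_diff_le_oscillation:
  assumes "x ` {1..n} \<subseteq> {0<..<1}" "y ` {1..n} \<subseteq> {0<..<1}" "0 \<le> t" "t \<le> 1"
  shows "\<bar>count_le n x t - count_le n y t\<bar> \<le> oscillation (\<lambda>t. count_le n x t - count_le n y t)"
proof -
  let ?h = "\<lambda>t. count_le n x t - count_le n y t"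
  have c: "0 \<le> count_le n z s \<and> count_le n z s \<le> n" for z s
    using sum_mono[of "{1..n}" "\<lambda>i. if z i \<le> s then 1 else 0" "\<lambda>_. 1::real"]
    by (auto simp: count_le_def intro: sum_nonneg)
  have "\<bar>?h t - ?h s\<bar> \<le> 2 * real n" for s t
    using c[of x s] c[of y s] c[of x t] c[of y t] by linarith
  then have "bdd_above ((\<lambda>(s, t). \<bar>?h t - ?h s\<bar>) ` ({0..1} \<times> {0..1}))"
    by (auto intro!: bdd_aboveI[of _ "2 * real n"])
  then have "(\<lambda>(s, t). \<bar>?h t - ?h s\<bar>) (0, t) \<le> oscillation ?h"
    unfolding oscillation_def using assms by (intro cSUP_upper) auto
  moreover have "count_le n x 0 = 0" "count_le n y 0 = 0"
    using assms by (force simp: count_le_def intro!: sum.neutral)+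
  ultimately show ?thesis by simp
qed

theorem lemma3p5:
  fixes \<alpha> :: real and n :: nat and x y :: "nat \<Rightarrow> real" and F F' :: "real \<Rightarrow> real"
  assumes "0 < \<alpha>" and "\<alpha> < 1" and "n \<ge> 2"
    and "x ` {1..n} \<subseteq> {0<..<1}" and "y ` {1..n} \<subseteq> {0<..<1}"
    and "inj_on x {1..n}" and "inj_on y {1..n}" and "x ` {1..n} \<inter> y ` {1..n} = {}"
  defines "F \<equiv> count_le n x" and "F' \<equiv> count_le n y"
  shows "boundary_matching_cost \<alpha> n x y =
           (INF (m, u, v) \<in> boundary_fams {m. real m \<le> oscillation (\<lambda>t. F t - F' t)}.
              matching_cost \<alpha> (n + m) (concat_fam n x u) (concat_fam n y v))
       \<and> boundary_tsp_cost \<alpha> n x y =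
           (INF (m, u, v) \<in> boundary_fams {m. real m \<le> oscillation (\<lambda>t. F t - F' t) + 1}.
              tsp_cost \<alpha> (n + m) (concat_fam n x u) (concat_fam n y v))"
proof -
  let ?X = "image_mset x (mset_set {1..n})" and ?Y = "image_mset y (mset_set {1..n})"
  define K where "K = oscillation (\<lambda>t. F t - F' t)"
  have h: "\<bar>real (num_le t ?X) - real (num_le t ?Y)\<bar> \<le> K" if "0 \<le> t" "t < 1" for t
    using abs_count_diff_le_oscillation[OF assms(4,5), of t] that
    unfolding num_le_family K_def F_def F'_def by simp
  have K: "0 \<le> K" using h[of 0] by simp
  have X: "set_mset ?X \<subseteq> {0..1}" "?X \<noteq> {#}" and Y: "set_mset ?Y \<subseteq> {0..1}" "?Y \<noteq> {#}"
    using assms(3-5) by (auto simp: mset_set_empty_iff)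
  have "boundary_matching_cost \<alpha> n x y = (INF (m, u, v) \<in> boundary_fams {m. real m \<le> K}.
      matching_cost \<alpha> (n + m) (concat_fam n x u) (concat_fam n y v))"
    unfolding boundary_matching_cost_def
  proof (rule boundary_reduction[OF K,
        where Z = "\<lambda>U V. matching (?X + U) (?Y + V)" and c = "pairs_cost \<alpha>"])
    fix U V :: "real multiset" and P and m :: nat
    assume *: "set_mset U \<subseteq> {0, 1}" "set_mset V \<subseteq> {0, 1}" "size U = m" "size V = m"
      and m: "K < m" and P: "matching (?X + U) (?Y + V) P"
    \<comment> \<open>The counts differ by at most \<open>K\<close>, and \<open>K < m\<close> makes
      both inequalities strict.\<close>
    have "num_le t ?X < num_le t ?Y + m \<and> num_le t ?Y < num_le t ?X + m"
      if "0 \<le> t" "t < 1" for t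
      using h[OF that] m by linarith
    moreover have "0 < m" using m K by linarith
    ultimately show "\<exists>U' V' P'. set_mset U' \<subseteq> {0, 1} \<and> set_mset V' \<subseteq> {0, 1} \<and> size U' = m - 1 \<and>
        size V' = m - 1 \<and> matching (?X + U') (?Y + V') P' \<and> pairs_cost \<alpha> P' \<le> pairs_cost \<alpha> P"
      using matching_reduce_step[OF assms(1,2) X(1) Y(1) * _ P] by blast
  next
    fix m :: nat and u v :: "nat \<Rightarrow> real"
    obtain P where "matching (image_mset (concat_fam n x u) (mset_set {1..n + m}))
          (image_mset (concat_fam n y v) (mset_set {1..n + m})) P"
        and P: "pairs_cost \<alpha> P = matching_cost \<alpha> (n + m) (concat_fam n x u) (concat_fam n y v)"
      by (rule matching_cost_attained)
    then show "\<exists>P. matching (?X + image_mset u (mset_set {1..m})) (?Y + image_mset v (mset_set {1..m})) P \<and>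
        pairs_cost \<alpha> P = matching_cost \<alpha> (n + m) (concat_fam n x u) (concat_fam n y v)"
      by (auto simp only: image_mset_concat_fam)
    have "0 \<le> pairs_cost \<alpha> P" by (induction P) auto
    then show "0 \<le> matching_cost \<alpha> (n + m) (concat_fam n x u) (concat_fam n y v)"
      using P by simp
  next
    fix m :: nat and u v :: "nat \<Rightarrow> real" and P
    assume "matching (?X + image_mset u (mset_set {1..m})) (?Y + image_mset v (mset_set {1..m})) P"
    then show "matching_cost \<alpha> (n + m) (concat_fam n x u) (concat_fam n y v) \<le> pairs_cost \<alpha> P"
      by (intro matching_cost_le) (simp only: image_mset_concat_fam)
  qed
  moreover have "boundary_tsp_cost \<alpha> n x y = (INF (m, u, v) \<in> boundary_fams {m. real m \<le> K + 1}.
      tsp_cost \<alpha> (n + m) (concat_fam n x u) (concat_fam n y v))"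
    unfolding boundary_tsp_cost_def
  proof (rule boundary_reduction[where Z = "\<lambda>U V. tour (?X + U) (?Y + V)" and c = "cycle_cost \<alpha>"])
    show "0 \<le> K + 1" using K by simp
  next
    fix U V :: "real multiset" and L and m :: nat
    assume *: "set_mset U \<subseteq> {0, 1}" "set_mset V \<subseteq> {0, 1}" "size U = m" "size V = m"
      and m: "K + 1 < m" and L: "tour (?X + U) (?Y + V) L"
    \<comment> \<open>The threshold \<open>K + 1\<close> leaves room for the \<open>Suc\<close>
      demanded by \<open>tour_reduce_step\<close>.\<close>
    have "Suc (num_le t ?X) < num_le t ?Y + m \<and> Suc (num_le t ?Y) < num_le t ?X + m"
      if "0 \<le> t" "t < 1" for t
      using h[OF that] m by linarith
    moreover have "0 < m" using m K by linarith
    ultimately show "\<exists>U' V' L'. set_mset U' \<subseteq> {0, 1} \<and> set_mset V' \<subseteq> {0, 1} \<and> size U' = m - 1 \<and>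
        size V' = m - 1 \<and> tour (?X + U') (?Y + V') L' \<and> cycle_cost \<alpha> L' \<le> cycle_cost \<alpha> L"
      using tour_reduce_step[OF assms(1,2) X Y * _ L] by blast
  next
    fix m :: nat and u v :: "nat \<Rightarrow> real"
    \<comment> \<open>Tours are nonempty lists, so one exists only for a positive number of points,
      even when \<open>m = 0\<close>.\<close>
    have "0 < n + m" using assms(3) by simp
    then obtain L where "tour (image_mset (concat_fam n x u) (mset_set {1..n + m}))
          (image_mset (concat_fam n y v) (mset_set {1..n + m})) L"
        and L: "cycle_cost \<alpha> L = tsp_cost \<alpha> (n + m) (concat_fam n x u) (concat_fam n y v)"
      by (rule tsp_cost_attained)
    then show "\<exists>L. tour (?X + image_mset u (mset_set {1..m})) (?Y + image_mset v (mset_set {1..m})) L \<and>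
        cycle_cost \<alpha> L = tsp_cost \<alpha> (n + m) (concat_fam n x u) (concat_fam n y v)"
      by (auto simp only: image_mset_concat_fam)
    have "0 \<le> walk_cost \<alpha> L"
      by (induction \<alpha> L rule: walk_cost.induct) (auto simp: step_cost_def)
    then have "0 \<le> cycle_cost \<alpha> L" by (simp add: cycle_cost_def step_cost_def)
    then show "0 \<le> tsp_cost \<alpha> (n + m) (concat_fam n x u) (concat_fam n y v)"
      using L by simp
  next
    fix m :: nat and u v :: "nat \<Rightarrow> real" and L
    assume "tour (?X + image_mset u (mset_set {1..m})) (?Y + image_mset v (mset_set {1..m})) L"
    then show "tsp_cost \<alpha> (n + m) (concat_fam n x u) (concat_fam n y v) \<le> cycle_cost \<alpha> L"
      by (intro tsp_cost_le) (simp only: image_mset_concat_fam)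
  qed
  ultimately show ?thesis unfolding K_def by blast
qed

end
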